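(* For all integers $n\geq 0$ and each $r\in\{14,34,74,94\}$, we have \[ \mathcal{EO}_u(100n+r)\equiv 0 \pmod{32}. \]
   Context: For a positive integer $k$, let $f_k:=(q^k;q^k)_\infty=\prod_{i=1}^\infty(1-q^{ki})$. The integers $\mathcal{EO}_u(n)$, $n\ge 0$, are defined by $\sum_{n=0}^\infty \mathcal{EO}_u(n)q^n=\dfrac{f_4^2}{f_2^2}$. *)

theory Defs
  imports "HOL-Analysis.Infinite_Products" "HOL-Computational_Algebra.Formal_Power_Series"
    "HOL-Number_Theory.Cong"
begin

text \<open>
  The \<open>q\<close>-series are formal power series over \<open>int\<close>, with \<open>q\<close> being \<^const>\<open>fps_X\<close>. The infinite
  product is the library's \<^const>\<open>prodinf\<close> with respect to the metric topology on formal power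
  series; it is indexed from 0, whence the \<^const>\<open>Suc\<close>.
\<close>

definition euler_f :: "nat \<Rightarrow> int fps" where
  "euler_f k = (\<Prod>i. 1 - fps_X ^ (k * Suc i))"

text \<open>
  As \<open>int\<close> is not a field, \<open>int fps\<close> has no division. The series \<open>(euler_f 2)\<^sup>2\<close> has constant
  coefficient 1, so \<open>fps_right_inverse _ 1\<close> is its multiplicative inverse; the lemmas
  \<open>EO_u_gf_times\<close> and \<open>EO_u_gf_unique\<close> below confirm that \<open>EO_u_gf\<close> is the quotient.
\<close>

definition EO_u_gf :: "int fps" where
  "EO_u_gf = (euler_f 4)\<^sup>2 * fps_right_inverse ((euler_f 2)\<^sup>2) 1"

definition EO_u :: "nat \<Rightarrow> int" where
  "EO_u n = fps_nth EO_u_gf n"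

lemma euler_f_has_prod_nth_0:
  assumes "k > 0"
  shows "(\<lambda>i. 1 - fps_X ^ (k * Suc i) :: int fps) has_prod euler_f k \<and> fps_nth (euler_f k) 0 = 1"
proof -
  let ?f = "\<lambda>i. 1 - fps_X ^ (k * Suc i) :: int fps"
  have nth0: "fps_nth (?f i) 0 = 1" for i
    using assms by simp
  have nz: "?f i \<noteq> 0" for i
    using nth0[of i] by (metis fps_zero_nth zero_neq_one)
  have sub: "subdegree (?f i - 1) > n" if "i > n" for n i
  proof -
    have "subdegree (?f i - 1) = k * Suc i"
      using subdegree_uminus[of "fps_X ^ (k * Suc i) :: int fps"] by (simp add: fps_X_power_subdegree)
    moreover have "Suc i \<le> k * Suc i"
      using assms by (cases k) auto
    ultimately show ?thesis using that by linarith
  qed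
  obtain P where P: "(\<lambda>n. \<Prod>i\<le>n. ?f i) \<longlonglongrightarrow> P"
    using tendsto_prod_fps[of ?f "\<lambda>n. n", OF nz sub] by blast
  have "eventually (\<lambda>n. fps_nth (\<Prod>i\<le>n. ?f i) 0 = fps_nth P 0) sequentially"
    using P unfolding tendsto_fps_iff by blast
  then obtain n where "fps_nth (\<Prod>i\<le>n. ?f i) 0 = fps_nth P 0"
    unfolding eventually_sequentially by blast
  moreover have "fps_nth (\<Prod>i\<le>n. ?f i) 0 = 1"
    using assms by (induction n) simp_all
  ultimately have P0: "fps_nth P 0 = 1" by simp
  hence "P \<noteq> 0" by auto
  with P have hp: "?f has_prod P"
    by (auto simp: has_prod_def raw_has_prod_def)
  with has_prod_unique[OF hp] P0 show ?thesis
    by (simp add: euler_f_def)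
qed

lemma EO_u_gf_times: "EO_u_gf * (euler_f 2)\<^sup>2 = (euler_f 4)\<^sup>2"
proof -
  have "fps_nth ((euler_f 2)\<^sup>2) 0 * 1 = 1"
    using euler_f_has_prod_nth_0[of 2] by (simp add: power2_eq_square)
  from fps_right_inverse[OF this] show ?thesis
    unfolding EO_u_gf_def by (simp add: mult_ac)
qed

lemma EO_u_gf_unique:
  assumes "A * (euler_f 2)\<^sup>2 = (euler_f 4)\<^sup>2"
  shows   "A = EO_u_gf"
proof -
  have "euler_f 2 \<noteq> 0"
    using euler_f_has_prod_nth_0[of 2] by auto
  thus ?thesis using assms EO_u_gf_times by (metis mult_right_cancel power_not_zero)
qed

end

theory Submission
  imports Defs
begin

text \<open>
  Write \<open>f\<^sub>k\<close> for \<open>euler_f k\<close> and \<open>\<phi>\<^sub>k(\<plusminus>) = \<Sum>j. (\<plusminus>1) ^ j * q ^ (k * j\<^sup>2)\<close>, \<open>B\<close> for the generating function.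
  Gauss' identity \<open>f\<^sub>k\<^sup>2 = f\<^sub>2\<^sub>k \<phi>\<^sub>k(-)\<close> gives \<open>B \<phi>\<^sub>2(-) = f\<^sub>4\<close>, and \<open>\<phi>\<^sub>2(+) \<phi>\<^sub>2(-) = \<phi>\<^sub>4(-)\<^sup>2\<close> turns this into
  \<open>B \<phi>\<^sub>4(-)\<^sup>2 = f\<^sub>4 \<phi>\<^sub>2(+)\<close>. As \<open>\<phi>\<^sub>4(-)\<^sup>2 = 1 + 4 V\<close> with \<open>V\<close> a series in \<open>q\<^sup>4\<close>,
  \<open>B = 16 V\<^sup>2 B + 2 f\<^sub>4 \<phi>\<^sub>2(+) - f\<^sub>4 \<phi>\<^sub>4(-)\<^sup>2 \<phi>\<^sub>2(+)\<close>.
  At exponents congruent to 2 modulo 4 the coefficients of \<open>B\<close> are even, so the first summand is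
  divisible by 32 there. Both \<open>f\<^sub>4\<close> (pentagonal number theorem) and
  \<open>f\<^sub>4 \<phi>\<^sub>4(-)\<^sup>2 = \<Sum>l. (6 l + 1) q ^ (2 l (3 l + 1))\<close> only involve exponents \<open>m\<close> for which \<open>6 m + 1\<close> is a square, so
  the other summands only involve exponents \<open>n\<close> with \<open>6 n + 1 = x\<^sup>2 + 12 y\<^sup>2\<close>. As \<open>-12\<close> is not a square modulo 5,
  such a number is never divisible exactly once by 5, whereas \<open>6 (100 n + r) + 1\<close> is.
\<close>

section \<open>Weighted theta series\<close>

text \<open>
  The formal series \<open>\<Sum>x\<in>S. c x * q ^ e x\<close>. Exponents are integers so that quadratic forms can be
  manipulated without truncated subtraction; a negative exponent, or an exponent attained
  infinitely often, contributes nothing, and \<open>proper\<close> excludes both.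
\<close>

definition theta :: "'a set \<Rightarrow> ('a \<Rightarrow> int) \<Rightarrow> ('a \<Rightarrow> int) \<Rightarrow> int fps" where
  "theta S c e = Abs_fps (\<lambda>n. \<Sum>x | x \<in> S \<and> e x = int n. c x)"

definition proper :: "'a set \<Rightarrow> ('a \<Rightarrow> int) \<Rightarrow> bool" where
  "proper S e \<longleftrightarrow> (\<forall>x\<in>S. 0 \<le> e x) \<and> (\<forall>n. finite {x \<in> S. e x \<le> n})"

lemma theta_nth: "fps_nth (theta S c e) n = (\<Sum>x | x \<in> S \<and> e x = int n. c x)"
  by (simp add: theta_def)

lemma proper_finite_fibre: "proper S e \<Longrightarrow> finite {x. x \<in> S \<and> e x = n}"
  unfolding proper_def by (rule finite_subset[of _ "{x \<in> S. e x \<le> n}"]) auto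

lemma theta_nth_eq_0:
  assumes "\<And>x. x \<in> S \<Longrightarrow> e x \<noteq> int n"
  shows "fps_nth (theta S c e) n = 0"
  unfolding theta_nth by (rule sum.neutral) (use assms in auto)

lemma theta_cong:
  assumes "\<And>x. x \<in> S \<Longrightarrow> c x = c' x" "\<And>x. x \<in> S \<Longrightarrow> e x = e' x"
  shows "theta S c e = theta S c' e'"
  unfolding fps_eq_iff theta_nth by (auto intro!: sum.cong simp: assms)

lemma theta_add: "theta S (\<lambda>x. c x + d x) e = theta S c e + theta S d e"
  by (simp add: fps_eq_iff theta_nth sum.distrib)

lemma theta_reindex:
  assumes "bij_betw h S' S"
  shows "theta S c e = theta S' (\<lambda>x. c (h x)) (\<lambda>x. e (h x))"
proof (rule fps_ext)
  fix n
  have "bij_betw h {x. x \<in> S' \<and> e (h x) = int n} {x. x \<in> S \<and> e x = int n}"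
    using assms unfolding bij_betw_def inj_on_def by auto
  thus "fps_nth (theta S c e) n = fps_nth (theta S' (\<lambda>x. c (h x)) (\<lambda>x. e (h x))) n"
    unfolding theta_nth by (rule sum.reindex_bij_betw[symmetric])
qed

lemma theta_Un:
  assumes "proper (A \<union> B) e" "A \<inter> B = {}"
  shows "theta (A \<union> B) c e = theta A c e + theta B c e"
proof (rule fps_ext)
  fix n
  have fin: "finite {x. x \<in> A \<union> B \<and> e x = int n}"
    by (rule proper_finite_fibre[OF assms(1)])
  have *: "{x. x \<in> A \<union> B \<and> e x = int n} = {x. x \<in> A \<and> e x = int n} \<union> {x. x \<in> B \<and> e x = int n}"
    by auto
  show "fps_nth (theta (A \<union> B) c e) n = fps_nth (theta A c e + theta B c e) n"
    unfolding theta_nth fps_add_nth using fin assms(2)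
    by (subst *, subst sum.union_disjoint) (auto intro: finite_subset[OF _ fin])
qed

text \<open>A sign-reversing involution that preserves exponents makes the series equal to its own
  negative.\<close>

lemma theta_eq_0:
  assumes "\<And>x. x \<in> S \<Longrightarrow> \<sigma> x \<in> S" "\<And>x. x \<in> S \<Longrightarrow> \<sigma> (\<sigma> x) = x"
    and "\<And>x. x \<in> S \<Longrightarrow> e (\<sigma> x) = e x" "\<And>x. x \<in> S \<Longrightarrow> c (\<sigma> x) = - c x"
  shows "theta S c e = 0"
proof -
  have "bij_betw \<sigma> S S"
    by (rule bij_betw_byWitness[of _ \<sigma>]) (use assms in auto)
  hence "theta S c e = theta S (\<lambda>x. c (\<sigma> x)) (\<lambda>x. e (\<sigma> x))"
    by (rule theta_reindex)
  also have "\<dots> = theta S (\<lambda>x. (-1) * c x) e"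
    by (rule theta_cong) (simp_all add: assms)
  also have "\<dots> = - theta S c e"
    by (simp add: fps_eq_iff theta_nth sum_negf)
  finally show ?thesis by (simp add: fps_eq_iff)
qed

lemma proper_times:
  assumes "proper S e" "proper T g"
  shows "proper (S \<times> T) (\<lambda>(x, y). e x + g y)"
  unfolding proper_def
proof (intro conjI allI)
  show "\<forall>x\<in>S \<times> T. 0 \<le> (case x of (x, y) \<Rightarrow> e x + g y)"
    using assms by (auto simp: proper_def)
  fix n
  have "{p \<in> S \<times> T. (case p of (x, y) \<Rightarrow> e x + g y) \<le> n} \<subseteq> {x \<in> S. e x \<le> n} \<times> {y \<in> T. g y \<le> n}"
    using assms by (force simp: proper_def)
  thus "finite {p \<in> S \<times> T. (case p of (x, y) \<Rightarrow> e x + g y) \<le> n}"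
    by (rule finite_subset) (use assms in \<open>auto simp: proper_def\<close>)
qed

lemma theta_mult:
  assumes "proper S e" "proper T g"
  shows "theta S c e * theta T d g = theta (S \<times> T) (\<lambda>(x, y). c x * d y) (\<lambda>(x, y). e x + g y)"
proof (rule fps_ext)
  fix n
  define R where "R = {p. p \<in> S \<times> T \<and> (case p of (x, y) \<Rightarrow> e x + g y) = int n}"
  have fin: "finite R"
    unfolding R_def by (rule proper_finite_fibre[OF proper_times[OF assms]])
  \<comment> \<open>The convolution groups the pairs of total exponent \<open>n\<close> by the
    exponent of their first entry; since \<open>e\<close> is nonnegative on \<open>S\<close>,
    \<open>nat\<close> loses nothing.\<close>
  have eq: "{p \<in> R. nat (e (fst p)) = i} = {x. x \<in> S \<and> e x = int i} \<times> {y. y \<in> T \<and> g y = int (n - i)}"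
    if "i \<le> n" for i
    using assms that by (force simp: R_def proper_def of_nat_diff)
  have "fps_nth (theta S c e * theta T d g) n
      = (\<Sum>i=0..n. \<Sum>(x, y)\<in>{p \<in> R. nat (e (fst p)) = i}. c x * d y)"
    unfolding fps_mult_nth theta_nth
    by (rule sum.cong) (simp_all add: eq sum_product sum.cartesian_product)
  also have "\<dots> = (\<Sum>(x, y)\<in>R. c x * d y)"
    by (rule sum.group) (use fin assms in \<open>auto simp: R_def proper_def nat_le_iff\<close>)
  finally show "fps_nth (theta S c e * theta T d g) n
      = fps_nth (theta (S \<times> T) (\<lambda>(x, y). c x * d y) (\<lambda>(x, y). e x + g y)) n"
    by (simp add: theta_nth R_def)
qed

section \<open>Congruence modulo a power of \<open>q\<close>\<close>

text \<open>Infinite products and sums are compared through finite truncations; equality follows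
  once agreement holds for every \<open>M\<close>.\<close>

definition agree :: "nat \<Rightarrow> int fps \<Rightarrow> int fps \<Rightarrow> bool" where
  "agree M a b \<longleftrightarrow> (\<forall>i<M. fps_nth a i = fps_nth b i)"

lemma agree_refl [simp]: "agree M a a"
  by (simp add: agree_def)

lemma agree_sym: "agree M a b \<Longrightarrow> agree M b a"
  by (simp add: agree_def)

lemma agree_trans [trans]: "agree M a b \<Longrightarrow> agree M b c \<Longrightarrow> agree M a c"
  by (simp add: agree_def)

lemma agree_mult: "agree M a b \<Longrightarrow> agree M c d \<Longrightarrow> agree M (a * c) (b * d)"
  unfolding agree_def fps_mult_nth by (auto intro!: sum.cong)

lemma agree_power: "agree M a b \<Longrightarrow> agree M (a ^ k) (b ^ k)"
  by (induction k) (auto intro: agree_mult)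

lemma agree_sum: "(\<And>x. x \<in> S \<Longrightarrow> agree M (f x) (g x)) \<Longrightarrow> agree M (sum f S) (sum g S)"
  unfolding agree_def fps_sum_nth by (auto intro!: sum.cong)

lemma agree_fps_X_power: "n \<ge> M \<Longrightarrow> agree M (a * fps_X ^ n) 0"
  by (auto simp: agree_def fps_X_power_mult_right_nth)

lemma agree_imp_eq: "(\<And>M. agree M a b) \<Longrightarrow> a = b"
  unfolding agree_def fps_eq_iff by blast

lemma agree_mult_cancel:
  assumes "fps_nth f 0 = 1" "agree M (f * a) (f * b)"
  shows "agree M a b"
proof -
  let ?g = "fps_right_inverse f 1"
  have "?g * f = 1" by (subst mult.commute, rule fps_right_inverse) (simp add: assms)
  hence "?g * (f * a) = a" "?g * (f * b) = b" by (simp_all only: mult.assoc[symmetric] mult_1_left)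
  thus ?thesis using agree_mult[OF agree_refl[of M ?g] assms(2)] by (simp only:)
qed

lemma agree_theta:
  assumes "finite F" "F \<subseteq> S" "\<And>x. x \<in> F \<Longrightarrow> 0 \<le> e x" "\<And>x. x \<in> S - F \<Longrightarrow> int M \<le> e x"
  shows "agree M (theta S c e) (\<Sum>x\<in>F. fps_const (c x) * fps_X ^ nat (e x))"
  unfolding agree_def
proof (intro allI impI)
  fix i assume "i < M"
  have "fps_nth (\<Sum>x\<in>F. fps_const (c x) * fps_X ^ nat (e x)) i = (\<Sum>x\<in>F. if e x = int i then c x else 0)"
    unfolding fps_sum_nth by (rule sum.cong) (use assms(3) in \<open>force simp: fps_X_power_nth\<close>)+
  also have "\<dots> = (\<Sum>x | x \<in> F \<and> e x = int i. c x)"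
    by (simp add: sum.If_cases assms(1) Collect_conj_eq)
  also have "{x. x \<in> F \<and> e x = int i} = {x. x \<in> S \<and> e x = int i}"
    using assms(2,4) \<open>i < M\<close> by force
  finally show "fps_nth (theta S c e) i = fps_nth (\<Sum>x\<in>F. fps_const (c x) * fps_X ^ nat (e x)) i"
    by (simp add: theta_nth)
qed

section \<open>Gaussian binomials\<close>

text \<open>Pascal's recurrence instead of a quotient of products: without division, any
  \<open>q\<close> in any commutative ring is allowed.\<close>

fun qbin :: "'a::comm_ring_1 \<Rightarrow> nat \<Rightarrow> nat \<Rightarrow> 'a" where
  "qbin q n 0 = 1"
| "qbin q 0 (Suc k) = 0"
| "qbin q (Suc n) (Suc k) = q ^ Suc k * qbin q n (Suc k) + qbin q n k"

text \<open>The finite Pochhammer symbol \<open>(q; q)_n\<close>.\<close>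

definition qpoch :: "'a::comm_ring_1 \<Rightarrow> nat \<Rightarrow> 'a" where
  "qpoch q n = (\<Prod>i<n. 1 - q ^ Suc i)"

lemma qpoch_0 [simp]: "qpoch q 0 = 1"
  by (simp add: qpoch_def)

lemma qpoch_Suc: "qpoch q (Suc n) = qpoch q n * (1 - q ^ Suc n)"
  by (simp add: qpoch_def)

lemma qbin_eq_0: "n < k \<Longrightarrow> qbin q n k = 0"
  by (induction q n k rule: qbin.induct) auto

text \<open>The quotient formula with denominators cleared. The two terms of the recurrence carry
  the factors \<open>q ^ Suc k * (1 - q ^ (n - k))\<close> and \<open>1 - q ^ Suc k\<close>, which
  add up to \<open>1 - q ^ Suc n\<close>.\<close>

lemma qbin_qpoch: "k \<le> n \<Longrightarrow> qbin q n k * qpoch q k * qpoch q (n - k) = qpoch q n"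
proof (induction q n k rule: qbin.induct)
  case (3 q n k)
  \<comment> \<open>The induction hypothesis is silent at \<open>k = n\<close>, where both sides
    vanish.\<close>
  have A: "qbin q n (Suc k) * qpoch q (Suc k) * qpoch q (n - k) = qpoch q n * (1 - q ^ (n - k))"
  proof (cases "k = n")
    case False
    with 3 have *: "n - k = Suc (n - Suc k)" by simp
    have "qpoch q (n - k) = qpoch q (n - Suc k) * (1 - q ^ (n - k))"
      unfolding * by (rule qpoch_Suc)
    moreover have "qbin q n (Suc k) * qpoch q (Suc k) * qpoch q (n - Suc k) = qpoch q n"
      using 3 False by simp
    ultimately show ?thesis by (simp only: mult.assoc[symmetric])
  qed (simp add: qbin_eq_0)
  have B: "qbin q n k * qpoch q (Suc k) * qpoch q (n - k) = qpoch q n * (1 - q ^ Suc k)"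
    using 3 unfolding qpoch_Suc by (metis Suc_leD Suc_le_mono mult.assoc mult.commute)
  have q: "q ^ Suc k * q ^ (n - k) = q ^ Suc n"
    using 3 by (simp flip: power_add power_Suc)
  have "qbin q (Suc n) (Suc k) * qpoch q (Suc k) * qpoch q (Suc n - Suc k)
     = q ^ Suc k * (qbin q n (Suc k) * qpoch q (Suc k) * qpoch q (n - k))
       + qbin q n k * qpoch q (Suc k) * qpoch q (n - k)"
    by (simp add: algebra_simps)
  also have "\<dots> = qpoch q n * (1 - q ^ Suc k * q ^ (n - k))"
    unfolding A B by (simp add: algebra_simps)
  finally show ?case
    by (simp only: q qpoch_Suc)
qed auto

lemma choose_two_Suc: "Suc k choose 2 = (k choose 2) + k"
  by (simp add: numeral_2_eq_2)

text \<open>Passing from \<open>z\<close> to \<open>z * q\<close> absorbs the power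
  \<open>q ^ k\<close>, which comes from Pascal's recurrence in one half and from
  \<open>Suc k choose 2\<close> in the other. The free weight \<open>w\<close> serves both the
  \<open>q\<close>-binomial theorem (\<open>w k = 1\<close>) and its derivative
  (\<open>w k = k\<close>).\<close>

lemma sum_qbin_Suc:
  "(\<Sum>k\<le>Suc n. w k * (q ^ (k choose 2) * qbin q (Suc n) k * z ^ k * y ^ (Suc n - k)))
   = y * (\<Sum>k\<le>n. w k * (q ^ (k choose 2) * qbin q n k * (z * q) ^ k * y ^ (n - k)))
   + z * (\<Sum>k\<le>n. w (Suc k) * (q ^ (k choose 2) * qbin q n k * (z * q) ^ k * y ^ (n - k)))"
proof -
  have "(\<Sum>k\<le>Suc n. w k * (q ^ (k choose 2) * qbin q (Suc n) k * z ^ k * y ^ (Suc n - k)))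
      = w 0 * y ^ Suc n + (\<Sum>k\<le>n. w (Suc k) * (q ^ (Suc k choose 2) * (q ^ Suc k * qbin q n (Suc k))
            * z ^ Suc k * y ^ (n - k)))
        + (\<Sum>k\<le>n. w (Suc k) * (q ^ (Suc k choose 2) * qbin q n k * z ^ Suc k * y ^ (n - k)))"
    by (subst sum.atMost_Suc_shift) (simp add: sum.distrib[symmetric] algebra_simps binomial_eq_0)
  also have "(\<Sum>k\<le>n. w (Suc k) * (q ^ (Suc k choose 2) * qbin q n k * z ^ Suc k * y ^ (n - k)))
     = z * (\<Sum>k\<le>n. w (Suc k) * (q ^ (k choose 2) * qbin q n k * (z * q) ^ k * y ^ (n - k)))"
    unfolding sum_distrib_left
    by (rule sum.cong) (simp_all only: choose_two_Suc power_add power_mult_distrib power_Suc mult_ac)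
  also have "w 0 * y ^ Suc n + (\<Sum>k\<le>n. w (Suc k) * (q ^ (Suc k choose 2) * (q ^ Suc k * qbin q n (Suc k))
            * z ^ Suc k * y ^ (n - k)))
     = (\<Sum>k\<le>Suc n. w k * (q ^ (k choose 2) * (q ^ k * qbin q n k) * z ^ k * y ^ (Suc n - k)))"
    by (subst sum.atMost_Suc_shift) (simp add: binomial_eq_0)
  also have "\<dots> = (\<Sum>k\<le>n. w k * (q ^ (k choose 2) * (q ^ k * qbin q n k) * z ^ k * y ^ (Suc n - k)))"
    by (simp add: qbin_eq_0)
  also have "\<dots> = y * (\<Sum>k\<le>n. w k * (q ^ (k choose 2) * qbin q n k * (z * q) ^ k * y ^ (n - k)))"
    unfolding sum_distrib_left
    by (rule sum.cong) (simp_all add: Suc_diff_le power_mult_distrib mult_ac)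
  finally show ?thesis .
qed

text \<open>The form homogeneous in \<open>y\<close> and \<open>z\<close> avoids negative powers of
  \<open>q\<close>: later \<open>y\<close> itself is a power of \<open>q\<close>.\<close>

lemma q_binomial_theorem:
  "(\<Prod>i<n. y + z * q ^ i) = (\<Sum>k\<le>n. q ^ (k choose 2) * qbin q n k * z ^ k * y ^ (n - k))"
proof (induction n arbitrary: z)
  case (Suc n)
  have "(\<Prod>i<Suc n. y + z * q ^ i) = (y + z) * (\<Prod>i<n. y + (z * q) * q ^ i)"
    by (subst prod.lessThan_Suc_shift) (simp add: mult_ac)
  thus ?case
    using sum_qbin_Suc[of "\<lambda>_. 1" q n z y] by (simp add: Suc distrib_right)
qed (simp add: numeral_2_eq_2)

lemma sum_of_nat_qbin_Suc:
  "(\<Sum>k\<le>Suc n. of_nat k * (q ^ (k choose 2) * qbin q (Suc n) k * z ^ k * y ^ (Suc n - k)))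
   = (y + z) * (\<Sum>k\<le>n. of_nat k * (q ^ (k choose 2) * qbin q n k * (z * q) ^ k * y ^ (n - k)))
   + z * (\<Sum>k\<le>n. q ^ (k choose 2) * qbin q n k * (z * q) ^ k * y ^ (n - k))"
  unfolding sum_qbin_Suc by (simp add: algebra_simps sum.distrib)

text \<open>
  Differentiating the \<open>q\<close>-binomial theorem in \<open>z\<close> at a zero of its \<open>m\<close>-th factor.
\<close>

lemma q_binomial_derivative:
  assumes "y + z * q ^ m = 0"
  shows "(\<Sum>k\<le>Suc (m + r). of_nat k * (q ^ (k choose 2) * qbin q (Suc (m + r)) k * z ^ k * y ^ (Suc (m + r) - k)))
    = (\<Prod>l<m. y + z * q ^ l) * (z * q ^ m) * (\<Prod>l<r. y + z * q ^ (Suc (m + l)))"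
  using assms
proof (induction m arbitrary: z)
  case 0
  let ?t = "\<lambda>k. q ^ (k choose 2) * qbin q r k * (z * q) ^ k * y ^ (r - k)"
  from 0 have y: "y = - z" by (simp add: eq_neg_iff_add_eq_0)
  have "(\<Sum>k\<le>Suc r. of_nat k * (q ^ (k choose 2) * qbin q (Suc r) k * z ^ k * y ^ (Suc r - k)))
     = (y + z) * (\<Sum>k\<le>r. of_nat k * ?t k) + z * (\<Sum>k\<le>r. ?t k)"
    by (rule sum_of_nat_qbin_Suc)
  also have "\<dots> = z * (\<Prod>l<r. y + (z * q) * q ^ l)"
    unfolding q_binomial_theorem by (simp add: y)
  finally show ?case by (simp add: mult_ac)
next
  case (Suc m)
  let ?t = "\<lambda>k. q ^ (k choose 2) * qbin q (Suc (m + r)) k * (z * q) ^ k * y ^ (Suc (m + r) - k)"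
  have z: "y + (z * q) * q ^ m = 0" using Suc.prems by (simp add: mult_ac)
  \<comment> \<open>The shifted product still contains the vanishing factor, so the unweighted sum
    drops out of the recurrence.\<close>
  have "(\<Prod>i<Suc (m + r). y + (z * q) * q ^ i) = 0"
    using z by (intro prod_zero) auto
  hence 0: "sum ?t {..Suc (m + r)} = 0" unfolding q_binomial_theorem .
  have "(\<Sum>k\<le>Suc (Suc m + r). of_nat k * (q ^ (k choose 2) * qbin q (Suc (Suc m + r)) k * z ^ k * y ^ (Suc (Suc m + r) - k)))
     = (y + z) * (\<Sum>k\<le>Suc (m + r). of_nat k * ?t k) + z * sum ?t {..Suc (m + r)}"
    unfolding add_Suc by (rule sum_of_nat_qbin_Suc)
  also have "\<dots> = (y + z) * ((\<Prod>l<m. y + (z * q) * q ^ l) * (z * q * q ^ m) * (\<Prod>l<r. y + (z * q) * q ^ (Suc (m + l))))"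
    unfolding 0 Suc.IH[OF z] by simp
  also have "\<dots> = (\<Prod>l<Suc m. y + z * q ^ l) * (z * q ^ Suc m) * (\<Prod>l<r. y + z * q ^ (Suc (Suc m + l)))"
    by (subst prod.lessThan_Suc_shift) (simp add: mult_ac)
  finally show ?case .
qed

section \<open>Passage from finite to infinite products\<close>

text \<open>Every factor beyond the first \<open>n\<close> is 1 modulo \<open>q ^ M\<close>, so the
  coefficients below \<open>M\<close> have already stabilised.\<close>

lemma agree_qpoch:
  assumes "k > 0" "n \<ge> M"
  shows "agree M (euler_f k) (qpoch (fps_X ^ k) n)"
proof -
  let ?q = "fps_X ^ k :: int fps"
  have step: "agree M (qpoch ?q n) (qpoch ?q (n + d))" for d
  proof (induction d)
    case (Suc d)
    have "M \<le> k * Suc (n + d)" using assms by (cases k) auto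
    hence "agree M (1 - ?q ^ Suc (n + d)) 1"
      unfolding power_mult[symmetric] agree_def fps_sub_nth fps_X_power_nth by auto
    from agree_mult[OF Suc this[THEN agree_sym]]
    show ?case by (simp only: qpoch_Suc add_Suc_right mult_1_right)
  qed simp
  have "(\<lambda>i. 1 - fps_X ^ (k * Suc i) :: int fps) has_prod euler_f k"
    using euler_f_has_prod_nth_0[OF assms(1)] by blast
  from has_prod_imp_tendsto'[OF this]
  have "(\<lambda>n. qpoch ?q n) \<longlonglongrightarrow> euler_f k"
    by (simp only: qpoch_def power_mult)
  hence lim: "eventually (\<lambda>n. fps_nth (qpoch ?q n) i = fps_nth (euler_f k) i) sequentially" for i
    unfolding tendsto_fps_iff by blast
  show ?thesis unfolding agree_def
  proof (intro allI impI)
    fix i assume i: "i < M"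
    from lim[of i] obtain N where "\<And>n. n \<ge> N \<Longrightarrow> fps_nth (qpoch ?q n) i = fps_nth (euler_f k) i"
      unfolding eventually_sequentially by blast
    from this[of "n + N"] step[of N] i
    show "fps_nth (euler_f k) i = fps_nth (qpoch ?q n) i"
      by (simp add: agree_def)
  qed
qed

lemma euler_f_nth_0: "k > 0 \<Longrightarrow> fps_nth (euler_f k) 0 = 1"
  using euler_f_has_prod_nth_0 by blast

lemma euler_f_nonzero: "k > 0 \<Longrightarrow> euler_f k \<noteq> 0"
  using euler_f_nth_0[of k] by auto

text \<open>With \<open>k\<close> and \<open>n - k\<close> both at least \<open>M\<close>, all three
  products in the quotient formula agree with \<open>euler_f s\<close>, so the Gaussian binomial
  acts as its inverse.\<close>

lemma agree_qbin:
  assumes "s > 0" "k \<ge> M" "n \<ge> k + M"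
  shows "agree M (qbin (fps_X ^ s) n k * euler_f s) 1"
proof (rule agree_mult_cancel)
  let ?q = "fps_X ^ s :: int fps"
  show "fps_nth (euler_f s) 0 = 1" by (rule euler_f_nth_0[OF assms(1)])
  have "agree M (qbin ?q n k * euler_f s * euler_f s) (qbin ?q n k * qpoch ?q k * qpoch ?q (n - k))"
    using assms by (intro agree_mult agree_qpoch agree_refl) auto
  also have "qbin ?q n k * qpoch ?q k * qpoch ?q (n - k) = qpoch ?q n"
    using assms by (intro qbin_qpoch) auto
  also have "agree M \<dots> (euler_f s)"
    using assms by (intro agree_sym[OF agree_qpoch]) auto
  finally show "agree M (euler_f s * (qbin (fps_X ^ s) n k * euler_f s)) (euler_f s * 1)"
    by (simp add: mult_ac)
qed

text \<open>A term either has exponent at least \<open>M\<close> and vanishes, or has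
  \<open>\<bar>k - n\<bar> \<le> M\<close>, and then its Gaussian binomial cancels against
  \<open>euler_f s\<close>. The slack of 1 in the bound on \<open>e\<close> accommodates
  \<open>tri 1 = 0\<close>; \<open>N\<close> is even for the triple product and odd for Jacobi's
  cube.\<close>

lemma agree_gauss_sum:
  assumes "s > 0" "N \<ge> 2 * n" "N \<le> Suc (2 * n)" "n \<ge> 2 * M + 1"
    and e: "\<And>j. 0 \<le> e j" "\<And>j. \<bar>j\<bar> \<le> e j + 1"
  shows "agree M ((\<Sum>k\<le>N. fps_const (c (int k - int n)) * qbin (fps_X ^ s) N k * fps_X ^ nat (e (int k - int n)))
           * euler_f s) (theta UNIV c e)"
proof -
  let ?q = "fps_X ^ s :: int fps"
  let ?j = "\<lambda>k. int k - int n"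
  have "agree M ((\<Sum>k\<le>N. fps_const (c (?j k)) * qbin ?q N k * fps_X ^ nat (e (?j k))) * euler_f s)
          (\<Sum>k\<le>N. fps_const (c (?j k)) * fps_X ^ nat (e (?j k)))"
    unfolding sum_distrib_right
  proof (rule agree_sum)
    fix k assume "k \<in> {..N}"
    show "agree M (fps_const (c (?j k)) * qbin ?q N k * fps_X ^ nat (e (?j k)) * euler_f s)
            (fps_const (c (?j k)) * fps_X ^ nat (e (?j k)))"
    proof (cases "e (?j k) \<ge> int M")
      case True
      hence "nat (e (?j k)) \<ge> M" by linarith
      thus ?thesis
        using agree_fps_X_power[of M "nat (e (?j k))" "fps_const (c (?j k)) * qbin ?q N k * euler_f s"]
          agree_fps_X_power[of M "nat (e (?j k))" "fps_const (c (?j k))"]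
        by (simp add: mult_ac agree_def)
    next
      case False
      hence "\<bar>?j k\<bar> \<le> int M" using e(2)[of "?j k"] by linarith
      hence "agree M (qbin ?q N k * euler_f s) 1"
        using assms by (intro agree_qbin) linarith+
      from agree_mult[OF agree_refl[of M "fps_const (c (?j k)) * fps_X ^ nat (e (?j k))"] this]
      show ?thesis by (simp add: mult_ac)
    qed
  qed
  also have "(\<Sum>k\<le>N. fps_const (c (?j k)) * fps_X ^ nat (e (?j k)))
      = (\<Sum>j\<in>{- int n..int N - int n}. fps_const (c j) * fps_X ^ nat (e j))"
    by (rule sum.reindex_bij_witness[of _ "\<lambda>j. nat (j + int n)" ?j]) auto
  also have "agree M \<dots> (theta UNIV c e)"
  proof (intro agree_sym[OF agree_theta])
    fix j assume "j \<in> UNIV - {- int n..int N - int n}"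
    hence "j < - int n \<or> int N - int n < j" by auto
    thus "int M \<le> e j" using e(2)[of j] assms(2,4) by linarith
  qed (use e in auto)
  finally show ?thesis .
qed

section \<open>The triple product and its specialisations\<close>

definition alt :: "int \<Rightarrow> int" where
  "alt j = (if even j then 1 else - 1)"

text \<open>The binomial coefficient \<open>j choose 2\<close>, continued to negative
  \<open>j\<close>.\<close>

definition tri :: "int \<Rightarrow> int" where
  "tri j = j * (j - 1) div 2"

lemma two_tri: "2 * tri j = j * (j - 1)"
  unfolding tri_def by (rule dvd_mult_div_cancel) simp

lemma tri_ge: "tri j \<ge> j - 1" "tri j \<ge> - j" "tri j \<ge> 0"
proof -
  have "2 * (tri j - (j - 1)) = (j - 1) * (j - 2)" "2 * (tri j + j) = j * (j + 1)"
    using two_tri[of j] by (simp_all add: algebra_simps)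
  moreover have "(j - 1) * (j - 2) \<ge> 0" "j * (j + 1) \<ge> 0" "j * (j - 1) \<ge> 0"
    by (simp_all add: zero_le_mult_iff; linarith)+
  ultimately have "2 * (tri j - (j - 1)) \<ge> 0" "2 * (tri j + j) \<ge> 0" "2 * tri j \<ge> 0"
    by (simp_all only: two_tri)
  thus "tri j \<ge> j - 1" "tri j \<ge> - j" "tri j \<ge> 0"
    by simp_all
qed

lemma tri_choose: "int (k choose 2) = tri (int k)"
proof (induction k)
  case (Suc k)
  thus ?case
    using two_tri[of "int k"] two_tri[of "int (Suc k)"] by (simp add: choose_two_Suc algebra_simps)
qed (simp add: tri_def binomial_eq_0)

lemma tri_add: "tri (n + j) = tri n + tri j + n * j"
  using two_tri[of n] two_tri[of j] two_tri[of "n + j"] by (simp add: algebra_simps)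

lemma minus_one_power_alt: "(-1) ^ k = (-1) ^ n * fps_const (alt (int k - int n))"
  by (auto simp: alt_def minus_one_power_iff simp flip: fps_const_neg)

lemma prod_lessThan_add:
  fixes f :: "nat \<Rightarrow> 'a::comm_monoid_mult"
  shows "(\<Prod>i<m + n. f i) = (\<Prod>i<m. f i) * (\<Prod>i<n. f (m + i))"
  by (induction n) (simp_all add: mult_ac)

lemma prod_fps_X_arith: "(\<Prod>i<n. fps_X ^ (a + s * i)) = (fps_X ^ (a * n + s * (n choose 2)) :: int fps)"
proof (induction n)
  case (Suc n)
  have "a * Suc n + s * (Suc n choose 2) = (a * n + s * (n choose 2)) + (a + s * n)"
    by (simp add: choose_two_Suc algebra_simps)
  thus ?case using Suc by (simp add: power_add)
qed (simp add: binomial_eq_0)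

text \<open>Reversing the order of the factors and pulling out the lower power of \<open>q\<close>
  turns \<open>a\<close> into \<open>s - a\<close>.\<close>

lemma prod_fps_X_diff:
  assumes "a \<le> s"
  shows "(\<Prod>i<n. fps_X ^ (s * n) - fps_X ^ (a + s * i) :: int fps)
    = (-1) ^ n * fps_X ^ (a * n + s * (n choose 2)) * (\<Prod>i<n. 1 - fps_X ^ (s - a + s * i))"
proof -
  have "(\<Prod>i<n. fps_X ^ (s * n) - fps_X ^ (a + s * i) :: int fps)
    = (\<Prod>i<n. fps_X ^ (s * n) - fps_X ^ (a + s * (n - Suc i)))"
    by (rule prod.nat_diff_reindex[symmetric])
  also have "\<dots> = (\<Prod>i<n. (-1) * fps_X ^ (a + s * (n - Suc i)) * (1 - fps_X ^ (s - a + s * i)))"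
  proof (rule prod.cong)
    fix i assume "i \<in> {..<n}"
    then obtain d where d: "n = Suc (d + i)" using less_imp_Suc_add[of i n] by (auto simp: add_ac)
    have e: "s * n = (a + s * (n - Suc i)) + (s - a + s * i)"
      using assms by (simp add: d algebra_simps)
    show "fps_X ^ (s * n) - fps_X ^ (a + s * (n - Suc i))
        = (-1) * fps_X ^ (a + s * (n - Suc i)) * (1 - fps_X ^ (s - a + s * i) :: int fps)"
      unfolding e power_add[of _ "a + s * (n - Suc i)"] by (simp add: right_diff_distrib)
  qed simp
  also have "\<dots> = (-1) ^ n * (\<Prod>i<n. fps_X ^ (a + s * (n - Suc i))) * (\<Prod>i<n. 1 - fps_X ^ (s - a + s * i))"
    by (simp only: prod.distrib prod_constant card_lessThan)
  also have "(\<Prod>i<n. fps_X ^ (a + s * (n - Suc i))) = (\<Prod>i<n. fps_X ^ (a + s * i) :: int fps)"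
    by (rule prod.nat_diff_reindex)
  also have "\<dots> = fps_X ^ (a * n + s * (n choose 2))"
    by (rule prod_fps_X_arith)
  finally show ?thesis .
qed

text \<open>Recentring at \<open>k = n\<close>: with \<open>j = k - n\<close>, the cross term
  \<open>s * n * j\<close> from \<open>tri_add\<close> cancels against
  \<open>s * n * (N - k)\<close>.\<close>

lemma gauss_exponent:
  assumes "k \<le> N" "n \<le> N" "0 \<le> int s * tri (int k - int n) + int a * (int k - int n)"
  shows "s * (k choose 2) + a * k + s * n * (N - k)
    = (a * n + s * (n choose 2) + s * n * (N - n)) + nat (int s * tri (int k - int n) + int a * (int k - int n))"
proof -
  have t: "tri (int k) = tri (int n) + tri (int k - int n) + int n * (int k - int n)"
    using tri_add[of "int n" "int k - int n"] by simp
  have "int (s * (k choose 2) + a * k + s * n * (N - k))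
    = int s * tri (int k) + int a * int k + int s * int n * (int N - int k)"
    using assms by (simp add: tri_choose of_nat_diff)
  also have "\<dots> = (int a * int n + int s * tri (int n) + int s * int n * (int N - int n))
       + (int s * tri (int k - int n) + int a * (int k - int n))"
    unfolding t by (simp add: algebra_simps)
  also have "\<dots> = int ((a * n + s * (n choose 2) + s * n * (N - n))
       + nat (int s * tri (int k - int n) + int a * (int k - int n)))"
    using assms by (simp add: tri_choose of_nat_diff)
  finally show ?thesis by (simp only: of_nat_eq_iff)
qed

lemma gauss_term:
  assumes "k \<le> N" "n \<le> N" "0 \<le> int s * tri (int k - int n) + int a * (int k - int n)"
  shows "(fps_X ^ s) ^ (k choose 2) * B * (- (fps_X ^ a)) ^ k * (fps_X ^ (s * n)) ^ (N - k)
    = ((-1) ^ n * fps_X ^ (a * n + s * (n choose 2) + s * n * (N - n))) *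
      (fps_const (alt (int k - int n)) * B * fps_X ^ nat (int s * tri (int k - int n) + int a * (int k - int n)) :: int fps)"
proof -
  have "(fps_X ^ s) ^ (k choose 2) * B * (- (fps_X ^ a)) ^ k * (fps_X ^ (s * n)) ^ (N - k)
    = (-1) ^ k * B * fps_X ^ (s * (k choose 2) + a * k + s * n * (N - k) :: nat)"
    by (subst power_minus) (simp add: power_add power_mult[symmetric] mult_ac)
  thus ?thesis
    unfolding gauss_exponent[OF assms] minus_one_power_alt[of k n] by (simp only: power_add mult_ac)
qed

lemma jacobi_exponent_ge:
  assumes "a > 0" "a < s"
  shows "\<bar>j\<bar> \<le> int s * tri j + int a * j"
proof (cases "j \<ge> 0")
  case True
  have "0 \<le> int s * tri j" using tri_ge(3) by simp
  moreover have "1 * j \<le> int a * j" using assms True by (intro mult_right_mono) auto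
  ultimately show ?thesis using True by linarith
next
  case False
  have "int s * (- j) \<le> int s * tri j" using tri_ge(2) by (intro mult_left_mono) auto
  moreover have "1 * (- j) \<le> (int s - int a) * (- j)" using assms False by (intro mult_right_mono) auto
  ultimately show ?thesis using False by (simp add: algebra_simps)
qed

text \<open>
  The \<open>q\<close>-binomial theorem for \<open>2 * n\<close> factors with its variable shifted by \<open>n\<close> steps, so that one half of
  the factors turns into the second product.
\<close>

lemma finite_triple_product:
  assumes "a > 0" "a < s"
  shows "(\<Prod>i<n. 1 - fps_X ^ (a + s * i)) * (\<Prod>i<n. 1 - fps_X ^ (s - a + s * i))
    = (\<Sum>k\<le>2 * n. fps_const (alt (int k - int n)) * qbin (fps_X ^ s) (2 * n) k *
         fps_X ^ nat (int s * tri (int k - int n) + int a * (int k - int n)) :: int fps)"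
proof -
  let ?A = "\<Prod>i<n. 1 - fps_X ^ (a + s * i) :: int fps"
  let ?B = "\<Prod>i<n. 1 - fps_X ^ (s - a + s * i) :: int fps"
  \<comment> \<open>The sign and power of \<open>q\<close> shared by both evaluations of the
    product; being nonzero, it cancels at the end.\<close>
  let ?c = "(-1) ^ n * fps_X ^ (a * n + s * (n choose 2) + s * n * (2 * n - n)) :: int fps"
  let ?f = "\<lambda>i. fps_X ^ (s * n) + - (fps_X ^ a) * (fps_X ^ s) ^ i :: int fps"
  have "(\<Prod>i<2 * n. ?f i) = (\<Prod>i<n. ?f i) * (\<Prod>i<n. ?f (n + i))"
    unfolding mult_2 by (rule prod_lessThan_add)
  also have "(\<Prod>i<n. ?f i) = (\<Prod>i<n. fps_X ^ (s * n) - fps_X ^ (a + s * i))"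
    by (simp add: power_add power_mult)
  also have "\<dots> = (-1) ^ n * fps_X ^ (a * n + s * (n choose 2)) * ?B"
    by (rule prod_fps_X_diff) (use assms in simp)
  also have "(\<Prod>i<n. ?f (n + i)) = (\<Prod>i<n. fps_X ^ (s * n) * (1 - fps_X ^ (a + s * i)))"
    by (simp add: power_add power_mult[symmetric] algebra_simps)
  also have "\<dots> = fps_X ^ (s * n * n) * ?A"
    by (simp only: prod.distrib prod_constant card_lessThan power_mult)
  finally have "(\<Prod>i<2 * n. ?f i) = ?c * (?A * ?B)"
    by (simp add: power_add mult_ac)
  moreover have "(\<Prod>i<2 * n. ?f i) = ?c * (\<Sum>k\<le>2 * n. fps_const (alt (int k - int n)) * qbin (fps_X ^ s) (2 * n) k *
         fps_X ^ nat (int s * tri (int k - int n) + int a * (int k - int n)))"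
    unfolding q_binomial_theorem sum_distrib_left
  proof (rule sum.cong)
    fix k assume "k \<in> {..2 * n}"
    thus "(fps_X ^ s) ^ (k choose 2) * qbin (fps_X ^ s) (2 * n) k * (- (fps_X ^ a)) ^ k * (fps_X ^ (s * n)) ^ (2 * n - k)
      = ?c * (fps_const (alt (int k - int n)) * qbin (fps_X ^ s) (2 * n) k *
         fps_X ^ nat (int s * tri (int k - int n) + int a * (int k - int n)) :: int fps)"
      using order_trans[OF abs_ge_zero jacobi_exponent_ge[OF assms]] by (intro gauss_term) auto
  qed simp
  ultimately have "?c * (?A * ?B) = ?c * (\<Sum>k\<le>2 * n. fps_const (alt (int k - int n)) * qbin (fps_X ^ s) (2 * n) k *
         fps_X ^ nat (int s * tri (int k - int n) + int a * (int k - int n)))"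
    by simp
  thus ?thesis by simp
qed

text \<open>Jacobi's triple product at a power of \<open>q\<close>. The factor
  \<open>euler_f s\<close> clears the limit of the Gaussian binomials; it is then truncated too, so
  that only finite products have to be dissected.\<close>

lemma triple_product:
  assumes "a > 0" "a < s" "n \<ge> 2 * M + 1"
  shows "agree M (theta UNIV alt (\<lambda>j. int s * tri j + int a * j))
     ((\<Prod>i<n. 1 - fps_X ^ (a + s * i)) * (\<Prod>i<n. 1 - fps_X ^ (s - a + s * i)) * qpoch (fps_X ^ s) n)"
proof -
  have "agree M ((\<Prod>i<n. 1 - fps_X ^ (a + s * i)) * (\<Prod>i<n. 1 - fps_X ^ (s - a + s * i)) * euler_f s)
     (theta UNIV alt (\<lambda>j. int s * tri j + int a * j))"
    unfolding finite_triple_product[OF assms(1,2)]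
  proof (rule agree_gauss_sum)
    fix j show "0 \<le> int s * tri j + int a * j" "\<bar>j\<bar> \<le> int s * tri j + int a * j + 1"
      using jacobi_exponent_ge[OF assms(1,2), of j] by linarith+
  qed (use assms in auto)
  moreover have "agree M ((\<Prod>i<n. 1 - fps_X ^ (a + s * i)) * (\<Prod>i<n. 1 - fps_X ^ (s - a + s * i)) * euler_f s)
     ((\<Prod>i<n. 1 - fps_X ^ (a + s * i)) * (\<Prod>i<n. 1 - fps_X ^ (s - a + s * i)) * qpoch (fps_X ^ s) n)"
    by (intro agree_mult agree_refl agree_qpoch) (use assms in auto)
  ultimately show ?thesis by (blast intro: agree_sym agree_trans)
qed

section \<open>Specialisations due to Gauss, Euler and Jacobi\<close>

lemma qpoch_split_2:
  "qpoch (fps_X ^ k) (2 * n) = (\<Prod>i<n. 1 - fps_X ^ (k + 2 * k * i)) * qpoch (fps_X ^ (2 * k)) n"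
  by (induction n) (simp_all add: qpoch_Suc power_mult[symmetric] algebra_simps flip: power_Suc power_add)

lemma qpoch_split_3:
  "qpoch (fps_X ^ k) (3 * n) = (\<Prod>i<n. 1 - fps_X ^ (k + 3 * k * i)) * (\<Prod>i<n. 1 - fps_X ^ (3 * k - k + 3 * k * i))
     * qpoch (fps_X ^ (3 * k)) n"
proof (induction n)
  case (Suc n)
  have 1: "3 * Suc n = Suc (Suc (Suc (3 * n)))" by simp
  have 2: "(fps_X ^ k) ^ Suc (3 * n) = (fps_X ^ (k + 3 * k * n) :: 'a fps)"
    "(fps_X ^ k) ^ Suc (Suc (3 * n)) = (fps_X ^ (3 * k - k + 3 * k * n) :: 'a fps)"
    "(fps_X ^ k) ^ Suc (Suc (Suc (3 * n))) = ((fps_X ^ (3 * k)) ^ Suc n :: 'a fps)"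
    unfolding power_mult[symmetric] by (simp_all add: algebra_simps)
  show ?case
    unfolding 1 qpoch_Suc Suc prod.lessThan_Suc 2 by (simp only: mult_ac)
qed simp

text \<open>The triple product at \<open>s = 2 * k\<close>, \<open>a = k\<close>: the two half
  products coincide, and with one more \<open>euler_f (2 * k)\<close> each is completed to
  \<open>euler_f k\<close>.\<close>

lemma gauss_square_theorem:
  assumes "k > 0"
  shows "theta UNIV alt (\<lambda>j. int k * j ^ 2) * euler_f (2 * k) = euler_f k ^ 2"
proof (rule agree_imp_eq)
  fix M :: nat
  let ?n = "2 * M + 1"
  let ?P = "\<Prod>i<?n. 1 - fps_X ^ (k + 2 * k * i) :: int fps"
  have e: "int k * j ^ 2 = int (2 * k) * tri j + int k * j" for j
  proof -
    have "int (2 * k) * tri j + int k * j = int k * (2 * tri j + j)" by (simp add: algebra_simps)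
    thus ?thesis unfolding two_tri by (simp add: algebra_simps power2_eq_square)
  qed
  have "agree M (theta UNIV alt (\<lambda>j. int k * j ^ 2)) (?P * ?P * qpoch (fps_X ^ (2 * k)) ?n)"
    unfolding e using triple_product[of k "2 * k" M ?n] assms by simp
  moreover have "agree M (euler_f (2 * k)) (qpoch (fps_X ^ (2 * k)) ?n)"
    by (rule agree_qpoch) (use assms in auto)
  ultimately have "agree M (theta UNIV alt (\<lambda>j. int k * j ^ 2) * euler_f (2 * k))
     (?P * ?P * qpoch (fps_X ^ (2 * k)) ?n * qpoch (fps_X ^ (2 * k)) ?n)"
    by (rule agree_mult)
  also have "?P * ?P * qpoch (fps_X ^ (2 * k)) ?n * qpoch (fps_X ^ (2 * k)) ?n = qpoch (fps_X ^ k) (2 * ?n) ^ 2"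
    unfolding qpoch_split_2 by (simp add: power2_eq_square mult_ac)
  also have "agree M \<dots> (euler_f k ^ 2)"
    by (intro agree_power agree_sym[OF agree_qpoch]) (use assms in auto)
  finally show "agree M (theta UNIV alt (\<lambda>j. int k * j ^ 2) * euler_f (2 * k)) (euler_f k ^ 2)" .
qed

text \<open>The triple product at \<open>s = 3 * k\<close>, \<open>a = k\<close>: its three products
  collect the residue classes of the index modulo 3.\<close>

lemma pentagonal_number_theorem:
  assumes "k > 0"
  shows "theta UNIV alt (\<lambda>j. int k * (3 * tri j + j)) = euler_f k"
proof (rule agree_imp_eq)
  fix M :: nat
  let ?n = "2 * M + 1"
  have e: "int k * (3 * tri j + j) = int (3 * k) * tri j + int k * j" for j
    by (simp add: algebra_simps)
  have "agree M (theta UNIV alt (\<lambda>j. int k * (3 * tri j + j))) (qpoch (fps_X ^ k) (3 * ?n))"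
    unfolding e qpoch_split_3 by (rule triple_product) (use assms in auto)
  also have "agree M \<dots> (euler_f k)"
    by (intro agree_sym[OF agree_qpoch]) (use assms in auto)
  finally show "agree M (theta UNIV alt (\<lambda>j. int k * (3 * tri j + j))) (euler_f k)" .
qed

text \<open>Among the \<open>2 * n + 1\<close> factors with \<open>z = - 1\<close> and
  \<open>y = fps_X ^ (s * n)\<close> the middle one vanishes; the derivative keeps the two halves
  around it, each contributing \<open>qpoch (fps_X ^ s) n\<close>.\<close>

lemma finite_jacobi_cube:
  assumes "s > 0"
  shows "2 * qpoch (fps_X ^ s) n ^ 2
    = (\<Sum>k\<le>Suc (2 * n). fps_const (alt (int k - int n) * (1 - 2 * (int k - int n))) * qbin (fps_X ^ s) (Suc (2 * n)) k *
         fps_X ^ nat (int s * tri (int k - int n)) :: int fps)"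
proof -
  let ?q = "fps_X ^ s :: int fps" and ?N = "Suc (2 * n)"
  let ?P = "qpoch ?q n"
  let ?c = "(-1) ^ n * fps_X ^ (s * (n choose 2) + s * n * (?N - n)) :: int fps"
  let ?t = "\<lambda>k. ?q ^ (k choose 2) * qbin ?q ?N k * (- 1) ^ k * (fps_X ^ (s * n)) ^ (?N - k)"
  let ?u = "\<lambda>k. fps_const (alt (int k - int n)) * qbin ?q ?N k * fps_X ^ nat (int s * tri (int k - int n))"
  have t: "?t k = ?c * ?u k" if "k \<le> ?N" for k
    using gauss_term[of k ?N n s 0 "qbin ?q ?N k"] that tri_ge(3)[of "int k - int n"] by simp
  have q: "?q ^ l = fps_X ^ (s * l)" for l by (simp add: power_mult)
  have m: "fps_X ^ (s * n) + (- 1) * ?q ^ n = 0" by (simp add: q)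
  have "(\<Prod>i<?N. fps_X ^ (s * n) + (- 1) * ?q ^ i) = 0"
    using m by (intro prod_zero) auto
  hence sum0: "(\<Sum>k\<le>?N. ?t k) = 0" unfolding q_binomial_theorem .
  have "(\<Sum>k\<le>?N. of_nat k * ?t k)
      = (\<Prod>l<n. fps_X ^ (s * n) + (- 1) * ?q ^ l) * (- 1 * ?q ^ n) * (\<Prod>l<n. fps_X ^ (s * n) + (- 1) * ?q ^ (Suc (n + l)))"
    using q_binomial_derivative[OF m, of n] unfolding mult_2 .
  also have "(\<Prod>l<n. fps_X ^ (s * n) + (- 1) * ?q ^ l) = (\<Prod>l<n. fps_X ^ (s * n) - fps_X ^ (0 + s * l))"
    by (simp add: q)
  also have "\<dots> = (-1) ^ n * fps_X ^ (s * (n choose 2)) * ?P"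
    by (subst prod_fps_X_diff) (simp_all add: qpoch_def power_mult[symmetric] flip: power_Suc power_add)
  also have "(\<Prod>l<n. fps_X ^ (s * n) + (- 1) * ?q ^ (Suc (n + l))) = (\<Prod>l<n. fps_X ^ (s * n) * (1 - ?q ^ Suc l))"
    by (rule prod.cong) (simp_all add: q power_add[symmetric] algebra_simps)
  also have "\<dots> = fps_X ^ (s * n * n) * ?P"
    by (simp only: prod.distrib prod_constant card_lessThan power_mult qpoch_def)
  also have "(-1) ^ n * fps_X ^ (s * (n choose 2)) * ?P * (- 1 * ?q ^ n) * (fps_X ^ (s * n * n) * ?P) = - (?c * ?P ^ 2)"
    by (simp add: q power2_eq_square mult_ac algebra_simps flip: power_add)
  \<comment> \<open>Adding \<open>?N\<close> times the vanishing sum turns the weight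
    \<open>- 2 * k\<close> into \<open>2 * n + 1 - 2 * k\<close>, that is \<open>1 - 2 * j\<close>
    with \<open>j = k - n\<close>.\<close>
  finally have "?c * (2 * ?P ^ 2) = of_nat ?N * (\<Sum>k\<le>?N. ?t k) - 2 * (\<Sum>k\<le>?N. of_nat k * ?t k)"
    by (simp add: sum0 del: sum.atMost_Suc)
  also have "\<dots> = (\<Sum>k\<le>?N. fps_const (1 - 2 * (int k - int n)) * ?t k)"
    unfolding sum_distrib_left sum_subtractf[symmetric]
    by (rule sum.cong) (simp_all add: fps_of_nat[symmetric] fps_numeral_fps_const algebra_simps flip: fps_const_add fps_const_sub fps_const_mult)
  also have "\<dots> = ?c * (\<Sum>k\<le>?N. fps_const (alt (int k - int n) * (1 - 2 * (int k - int n))) * qbin ?q ?N k *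
         fps_X ^ nat (int s * tri (int k - int n)))"
    unfolding sum_distrib_left
    by (rule sum.cong, simp, subst t, simp, simp only: fps_const_mult[symmetric] mult_ac)
  finally show ?thesis by (simp del: sum.atMost_Suc)
qed

text \<open>The indices \<open>j\<close> and \<open>1 - j\<close> contribute equally, whence the
  factor 2 compared with the usual one-sided series.\<close>

lemma jacobi_cube:
  assumes "k > 0"
  shows "theta UNIV (\<lambda>j. alt j * (1 - 2 * j)) (\<lambda>j. int k * tri j) = 2 * euler_f k ^ 3"
proof (rule agree_imp_eq)
  fix M :: nat
  let ?n = "2 * M + 1"
  have "agree M (2 * qpoch (fps_X ^ k) ?n ^ 2 * euler_f k) (theta UNIV (\<lambda>j. alt j * (1 - 2 * j)) (\<lambda>j. int k * tri j))"
    unfolding finite_jacobi_cube[OF assms]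
  proof (rule agree_gauss_sum)
    fix j
    have "1 * tri j \<le> int k * tri j" using assms tri_ge(3) by (intro mult_right_mono) auto
    thus "0 \<le> int k * tri j" "\<bar>j\<bar> \<le> int k * tri j + 1"
      using tri_ge[of j] by linarith+
  qed (use assms in auto)
  moreover have "agree M (2 * qpoch (fps_X ^ k) ?n ^ 2 * euler_f k) (2 * euler_f k ^ 2 * euler_f k)"
    by (intro agree_mult agree_power agree_refl agree_sym[OF agree_qpoch]) (use assms in auto)
  ultimately show "agree M (theta UNIV (\<lambda>j. alt j * (1 - 2 * j)) (\<lambda>j. int k * tri j)) (2 * euler_f k ^ 3)"
    by (simp only: power3_eq_cube power2_eq_square mult.assoc) (blast intro: agree_sym agree_trans)
qed

section \<open>Products of theta series\<close>

lemma proper_subset: "proper S e \<Longrightarrow> T \<subseteq> S \<Longrightarrow> proper T e"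
  unfolding proper_def
proof (intro conjI allI)
  fix n
  assume "(\<forall>x\<in>S. 0 \<le> e x) \<and> (\<forall>n. finite {x \<in> S. e x \<le> n})" "T \<subseteq> S"
  thus "finite {x \<in> T. e x \<le> n}"
    by (intro finite_subset[of "{x \<in> T. e x \<le> n}" "{x \<in> S. e x \<le> n}"]) auto
qed blast

lemma properI:
  assumes "\<And>j. \<bar>j\<bar> \<le> e j"
  shows "proper UNIV (e :: int \<Rightarrow> int)"
  unfolding proper_def
proof (intro conjI allI ballI)
  show "0 \<le> e j" for j using assms[of j] by linarith
  have "- n \<le> j \<and> j \<le> n" if "e j \<le> n" for j n
    using assms[of j] that by (intro conjI) linarith+
  hence "{j \<in> UNIV. e j \<le> n} \<subseteq> {- n..n}" for n
    unfolding subset_iff mem_Collect_eq atLeastAtMost_iff by blast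
  thus "finite {j \<in> UNIV. e j \<le> n}" for n
    by (rule finite_subset[OF _ finite_atLeastAtMost_int])
qed

text \<open>\<open>properI\<close> does not apply here, since \<open>tri 1 = 0\<close>; the range of
  \<open>j\<close> has to be widened by 1.\<close>

lemma proper_tri: "k > 0 \<Longrightarrow> proper UNIV (\<lambda>j. int k * tri j)"
  unfolding proper_def
proof (intro conjI allI ballI)
  assume k: "k > 0"
  show "0 \<le> int k * tri j" for j using tri_ge(3) by simp
  have "- (n + 1) \<le> j \<and> j \<le> n + 1" if "int k * tri j \<le> n" for j n
  proof -
    have "1 * tri j \<le> int k * tri j" using k tri_ge(3) by (intro mult_right_mono) auto
    thus ?thesis using that tri_ge[of j] by (intro conjI) linarith+
  qed
  hence "{j \<in> UNIV. int k * tri j \<le> n} \<subseteq> {- (n + 1)..n + 1}" for n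
    unfolding subset_iff mem_Collect_eq atLeastAtMost_iff by blast
  thus "finite {j \<in> UNIV. int k * tri j \<le> n}" for n
    by (rule finite_subset[OF _ finite_atLeastAtMost_int])
qed

lemma proper_square: "k > 0 \<Longrightarrow> proper UNIV (\<lambda>j. int k * j ^ 2)"
proof (rule properI)
  fix j :: int assume k: "k > 0"
  have "1 * \<bar>j\<bar> \<le> \<bar>j\<bar> * \<bar>j\<bar>" by (cases "j = 0") (simp, intro mult_right_mono, auto)
  also have "\<dots> = 1 * j ^ 2" by (simp add: power2_eq_square)
  also have "\<dots> \<le> int k * j ^ 2" using k by (intro mult_right_mono) auto
  finally show "\<bar>j\<bar> \<le> int k * j ^ 2" by simp
qed

lemma proper_pentagonal:
  assumes "k > 0" "a \<in> {1, 2}"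
  shows "proper UNIV (\<lambda>j. int k * (3 * tri j + a * j))"
proof (rule properI)
  fix j
  have j: "\<bar>j\<bar> \<le> 3 * tri j + a * j" using jacobi_exponent_ge[of "nat a" 3 j] assms by auto
  also have "\<dots> = 1 * (3 * tri j + a * j)" by simp
  also have "\<dots> \<le> int k * (3 * tri j + a * j)"
    using assms j by (intro mult_right_mono) auto
  finally show "\<bar>j\<bar> \<le> int k * (3 * tri j + a * j)" .
qed

lemma alt_simps [simp]:
  "alt 0 = 1" "alt (- j) = alt j" "alt (i + 1) = - alt i" "alt (1 - i) = - alt i"
  by (auto simp: alt_def)

text \<open>Swapping cancels the pairs of opposite parity. Those of equal parity are
  \<open>(a + b, a - b)\<close>, with sum of squares \<open>2 * (a ^ 2 + b ^ 2)\<close> and sign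
  \<open>alt a * alt b\<close>.\<close>

lemma theta_square_product:
  assumes "k > 0"
  shows "theta UNIV (\<lambda>_. 1) (\<lambda>j. int k * j ^ 2) * theta UNIV alt (\<lambda>j. int k * j ^ 2)
    = theta UNIV alt (\<lambda>j. int (2 * k) * j ^ 2) ^ 2"
proof -
  let ?A = "{(x, y). even (x + y :: int)}" and ?B = "{(x, y). odd (x + y :: int)}"
  let ?c = "\<lambda>(x :: int, y). 1 * alt y"
  let ?e = "\<lambda>(x, y). int k * x ^ 2 + int k * y ^ 2"
  note p = proper_square[OF assms]
  have U: "UNIV \<times> UNIV = ?A \<union> ?B" by auto
  have "theta UNIV (\<lambda>_. 1) (\<lambda>j. int k * j ^ 2) * theta UNIV alt (\<lambda>j. int k * j ^ 2) = theta (?A \<union> ?B) ?c ?e"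
    unfolding theta_mult[OF p p] U ..
  also have "\<dots> = theta ?A ?c ?e + theta ?B ?c ?e"
    by (rule theta_Un) (use proper_times[OF p p] U in auto)
  also have "theta ?B ?c ?e = 0"
    by (rule theta_eq_0[of _ prod.swap]) (auto simp: alt_def)
  also have "theta ?A ?c ?e = theta (UNIV \<times> UNIV) (\<lambda>x. ?c (case x of (a, b) \<Rightarrow> (a + b, a - b)))
      (\<lambda>x. ?e (case x of (a, b) \<Rightarrow> (a + b, a - b)))"
    by (rule theta_reindex, rule bij_betw_byWitness[of _ "\<lambda>(x, y). ((x + y) div 2, (x - y) div 2)"]) (auto; presburger)+
  also have "\<dots> = theta (UNIV \<times> UNIV) (\<lambda>(x, y). alt x * alt y)
      (\<lambda>(x, y). int (2 * k) * x ^ 2 + int (2 * k) * y ^ 2)"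
    by (rule theta_cong) (auto simp: alt_def power2_eq_square algebra_simps)
  also have "\<dots> = theta UNIV alt (\<lambda>j. int (2 * k) * j ^ 2) ^ 2"
    by (subst power2_eq_square, rule theta_mult[symmetric]; rule proper_square) (use assms in auto)
  finally show ?thesis by simp
qed

text \<open>
  The series \<open>\<Sum>n. (-1) ^ n * q ^ (k * n\<^sup>2)\<close> times Jacobi's series for the cube of \<open>euler_f k\<close>
  is a double sum over \<open>(j, n)\<close>. The antisymmetry \<open>j \<mapsto> 1 - j\<close> allows the weight \<open>1 - 2 * j\<close> to be
  replaced by \<open>1 - 2 * j - 4 * n\<close>, which depends on \<open>j + 2 * n\<close> only. Summing over the
  classes of \<open>j + 2 * n\<close> modulo 3, one class cancels and the other two factor in the same way. This is
  the Carlitz--Subbarao proof of the quintuple product identity, differentiated at \<open>z = 1\<close>.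
\<close>

lemma euler_f_times_theta_square:
  assumes k: "k > 0"
  shows "euler_f k * theta UNIV alt (\<lambda>j. int k * j ^ 2) ^ 2
    = theta UNIV (\<lambda>l. 6 * l + 1) (\<lambda>l. int k * (3 * tri l + 2 * l))"
proof -
  let ?P = "theta UNIV alt (\<lambda>j. int k * j ^ 2)"
  let ?G = "theta UNIV (\<lambda>l. 6 * l + 1) (\<lambda>l. int k * (3 * tri l + 2 * l))"
  let ?C = "\<lambda>r. {(j, n). (j + 2 * n) mod 3 = (r :: int)}"
  let ?c = "\<lambda>(j, n). (1 - 2 * j - 4 * n) * (alt j * alt n)"
  let ?e = "\<lambda>(j, n). int k * tri j + int k * n ^ 2"
  have p: "proper (UNIV \<times> UNIV) ?e"
    by (rule proper_times[OF proper_tri[OF k] proper_square[OF k]])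
  have tri_reflect: "tri (1 - j) = tri j" for j by (simp add: tri_def algebra_simps)
  have "2 * euler_f k ^ 3 * ?P
      = theta (UNIV \<times> UNIV) (\<lambda>(j, n). (alt j * (1 - 2 * j)) * alt n) ?e"
    unfolding jacobi_cube[OF k, symmetric] by (rule theta_mult[OF proper_tri[OF k] proper_square[OF k]])
  also have "\<dots> = theta (UNIV \<times> UNIV) (\<lambda>x. ?c x + (\<lambda>(j, n). 4 * n * (alt j * alt n)) x) ?e"
    by (rule theta_cong) (auto simp: algebra_simps)
  also have "\<dots> = theta (UNIV \<times> UNIV) ?c ?e + theta (UNIV \<times> UNIV) (\<lambda>(j, n). 4 * n * (alt j * alt n)) ?e"
    by (rule theta_add)
  also have "theta (UNIV \<times> UNIV) (\<lambda>(j, n). 4 * n * (alt j * alt n)) ?e = 0"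
    by (rule theta_eq_0[of _ "\<lambda>(j, n). (1 - j, n)"]) (auto simp: tri_reflect)
  also have "theta (UNIV \<times> UNIV) ?c ?e = theta (?C 0) ?c ?e + theta (?C 1) ?c ?e + theta (?C 2) ?c ?e"
  proof -
    have U: "UNIV \<times> UNIV = ?C 0 \<union> ?C 1 \<union> ?C 2" by auto
    have p': "proper (?C 0 \<union> ?C 1) ?e"
      by (rule proper_subset[OF p]) simp
    have "theta (UNIV \<times> UNIV) ?c ?e = theta (?C 0 \<union> ?C 1) ?c ?e + theta (?C 2) ?c ?e"
      unfolding U by (rule theta_Un) (use p in \<open>simp only: U\<close>, auto)
    also have "theta (?C 0 \<union> ?C 1) ?c ?e = theta (?C 0) ?c ?e + theta (?C 1) ?c ?e"
      by (rule theta_Un[OF p']) auto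
    finally show ?thesis .
  qed
  also have "theta (?C 2) ?c ?e = 0"
  proof -
    \<comment> \<open>Here \<open>j + 2 * n\<close> becomes \<open>3 * l + 2\<close>, so the weight
      depends on \<open>l\<close> only and the sign is \<open>alt n\<close>; the map
      \<open>n \<mapsto> 1 - n\<close> keeps the exponent and flips the sign.\<close>
    let ?h = "\<lambda>(l, n). (l - 2 * n + 2, l + n)"
    have "theta (?C 2) ?c ?e = theta (UNIV \<times> UNIV) (\<lambda>x. ?c (?h x)) (\<lambda>x. ?e (?h x))"
      by (rule theta_reindex, rule bij_betw_byWitness[of _ "\<lambda>(j, n). ((j + 2 * n) div 3, n - (j + 2 * n) div 3)"])
         (auto; presburger)+
    also have "\<dots> = 0"
    proof (rule theta_eq_0[of _ "\<lambda>(l, n). (l, 1 - n)"])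
      fix x :: "int \<times> int"
      obtain l n where x: "x = (l, n)" by force
      have "tri (l - 2 * (1 - n) + 2) + (l + (1 - n)) ^ 2 = tri (l - 2 * n + 2) + (l + n) ^ 2"
        using two_tri[of "l - 2 * (1 - n) + 2"] two_tri[of "l - 2 * n + 2"]
        by (simp add: algebra_simps power2_eq_square)
      thus "?e (?h (case x of (l, n) \<Rightarrow> (l, 1 - n))) = ?e (?h x)"
        unfolding x by (simp flip: distrib_left)
      show "?c (?h (case x of (l, n) \<Rightarrow> (l, 1 - n))) = - ?c (?h x)"
        by (simp add: x alt_def)
    qed auto
    finally show ?thesis .
  qed
  also have "theta (?C 1) ?c ?e = ?G * euler_f (2 * k)"
  proof -
    \<comment> \<open>Here \<open>j + 2 * n\<close> becomes \<open>3 * l + 1\<close>: the weight is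
      \<open>- (6 * l + 1)\<close>, the sign \<open>- alt n\<close>, and the quadratic form becomes
      diagonal.\<close>
    let ?h = "\<lambda>(l, n). (l - 2 * n + 1, l + n)"
    have "theta (?C 1) ?c ?e = theta (UNIV \<times> UNIV) (\<lambda>x. ?c (?h x)) (\<lambda>x. ?e (?h x))"
      by (rule theta_reindex, rule bij_betw_byWitness[of _ "\<lambda>(j, n). ((j + 2 * n) div 3, n - (j + 2 * n) div 3)"])
         (auto; presburger)+
    also have "\<dots> = theta (UNIV \<times> UNIV) (\<lambda>(l, n). (6 * l + 1) * alt n)
        (\<lambda>(l, n). int k * (3 * tri l + 2 * l) + int (2 * k) * (3 * tri n + 1 * n))"
    proof (rule theta_cong)
      fix x :: "int \<times> int"
      obtain l n where x: "x = (l, n)" by force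
      have "tri (l - 2 * n + 1) + (l + n) ^ 2 = (3 * tri l + 2 * l) + 2 * (3 * tri n + n)"
        using two_tri[of "l - 2 * n + 1"] two_tri[of l] two_tri[of n]
        by (simp add: algebra_simps power2_eq_square)
      from arg_cong[OF this, of "\<lambda>t. int k * t"]
      show "?e (?h x) = (\<lambda>(l, n). int k * (3 * tri l + 2 * l) + int (2 * k) * (3 * tri n + 1 * n)) x"
        by (simp add: x algebra_simps)
      show "?c (?h x) = (\<lambda>(l, n). (6 * l + 1) * alt n) x"
        by (simp add: x alt_def)
    qed
    also have "\<dots> = ?G * theta UNIV alt (\<lambda>n. int (2 * k) * (3 * tri n + 1 * n))"
      by (rule theta_mult[symmetric]; rule proper_pentagonal) (use k in auto)
    also have "theta UNIV alt (\<lambda>n. int (2 * k) * (3 * tri n + 1 * n)) = euler_f (2 * k)"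
      using pentagonal_number_theorem[of "2 * k"] k by simp
    finally show ?thesis .
  qed
  also have "theta (?C 0) ?c ?e = ?G * euler_f (2 * k)"
  proof -
    \<comment> \<open>Here \<open>j + 2 * n\<close> becomes \<open>- 3 * l\<close>; the sign of
      \<open>l\<close> is chosen so that weight and exponent match the previous class.\<close>
    let ?h = "\<lambda>(l, n). (2 * n - l, - l - n)"
    have "theta (?C 0) ?c ?e = theta (UNIV \<times> UNIV) (\<lambda>x. ?c (?h x)) (\<lambda>x. ?e (?h x))"
      by (rule theta_reindex, rule bij_betw_byWitness[of _ "\<lambda>(j, n). (- ((j + 2 * n) div 3), (j + 2 * n) div 3 - n)"])
         (auto; presburger)+
    also have "\<dots> = theta (UNIV \<times> UNIV) (\<lambda>(l, n). (6 * l + 1) * alt n)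
        (\<lambda>(l, n). int k * (3 * tri l + 2 * l) + int (2 * k) * (3 * tri n + 1 * n))"
    proof (rule theta_cong)
      fix x :: "int \<times> int"
      obtain l n where x: "x = (l, n)" by force
      have "tri (2 * n - l) + (- l - n) ^ 2 = (3 * tri l + 2 * l) + 2 * (3 * tri n + n)"
        using two_tri[of "2 * n - l"] two_tri[of l] two_tri[of n]
        by (simp add: algebra_simps power2_eq_square)
      from arg_cong[OF this, of "\<lambda>t. int k * t"]
      show "?e (?h x) = (\<lambda>(l, n). int k * (3 * tri l + 2 * l) + int (2 * k) * (3 * tri n + 1 * n)) x"
        by (simp add: x algebra_simps)
      show "?c (?h x) = (\<lambda>(l, n). (6 * l + 1) * alt n) x"
        by (simp add: x alt_def)
    qed
    also have "\<dots> = ?G * theta UNIV alt (\<lambda>n. int (2 * k) * (3 * tri n + 1 * n))"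
      by (rule theta_mult[symmetric]; rule proper_pentagonal) (use k in auto)
    also have "theta UNIV alt (\<lambda>n. int (2 * k) * (3 * tri n + 1 * n)) = euler_f (2 * k)"
      using pentagonal_number_theorem[of "2 * k"] k by simp
    finally show ?thesis .
  qed
  finally have "2 * euler_f k ^ 3 * ?P = 2 * (?G * euler_f (2 * k))" by simp
  \<comment> \<open>Gauss' identity rewrites the cube with a factor \<open>euler_f (2 * k)\<close>,
    which then cancels.\<close>
  moreover have "euler_f k ^ 3 = euler_f k * (?P * euler_f (2 * k))"
    unfolding gauss_square_theorem[OF k] by (simp add: power3_eq_cube power2_eq_square)
  ultimately have "(euler_f k * ?P ^ 2) * euler_f (2 * k) = ?G * euler_f (2 * k)"
    by (simp add: power2_eq_square mult_ac)
  thus ?thesis using euler_f_nonzero[of "2 * k"] k by simp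
qed

section \<open>Parity and series in \<open>q ^ 4\<close>\<close>

text \<open>Pairing \<open>j\<close> with \<open>- j\<close> leaves only the constant term; this is
  where the powers of 2 originate.\<close>

lemma theta_even_split:
  assumes "proper UNIV e" "\<And>j. c (- j) = c j" "\<And>j. e (- j) = e j" "\<And>j. e j = 0 \<longleftrightarrow> j = 0" "c 0 = 1"
  shows "theta UNIV c e = 1 + 2 * theta {0<..} c (e :: int \<Rightarrow> int)"
proof -
  have U: "UNIV = {0 :: int} \<union> ({0<..} \<union> {..<0})" by auto
  have p: "proper ({0<..} \<union> {..<0}) e"
    by (rule proper_subset[OF assms(1)]) simp
  have 0: "theta {0} c e = 1"
    using assms(4)[of 0] assms(5) by (auto simp: fps_eq_iff theta_nth Collect_conj_eq)
  have "theta {..<0} c e = theta {0<..} (\<lambda>j. c (- j)) (\<lambda>j. e (- j))"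
    by (rule theta_reindex, rule bij_betw_byWitness[of _ uminus]) auto
  hence "theta {..<0} c e = theta {0<..} c e" by (simp only: assms)
  moreover have "theta UNIV c e = theta {0} c e + theta ({0<..} \<union> {..<0}) c e"
    unfolding U by (rule theta_Un) (simp only: U[symmetric] assms(1), auto)
  moreover have "theta ({0<..} \<union> {..<0}) c e = theta {0<..} c e + theta {..<0} c e"
    by (rule theta_Un[OF p]) auto
  ultimately show ?thesis using 0 by simp
qed

definition supp4 :: "int fps \<Rightarrow> bool" where
  "supp4 A \<longleftrightarrow> (\<forall>n. \<not> 4 dvd n \<longrightarrow> fps_nth A n = 0)"

lemma supp4_mult: "supp4 A \<Longrightarrow> supp4 B \<Longrightarrow> supp4 (A * B)"
  unfolding supp4_def fps_mult_nth
proof (intro allI impI sum.neutral ballI)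
  fix n i :: nat
  assume *: "\<forall>n. \<not> 4 dvd n \<longrightarrow> fps_nth A n = 0" "\<forall>n. \<not> 4 dvd n \<longrightarrow> fps_nth B n = 0"
    "\<not> 4 dvd n" "i \<in> {0..n}"
  hence "\<not> 4 dvd i \<or> \<not> 4 dvd (n - i)" using dvd_add[of 4 i "n - i"] by auto
  thus "fps_nth A i * fps_nth B (n - i) = 0" using * by auto
qed

lemma supp4_add: "supp4 A \<Longrightarrow> supp4 B \<Longrightarrow> supp4 (A + B)"
  by (simp add: supp4_def)

lemma supp4_theta: "supp4 (theta S c (\<lambda>x. int 4 * e x))"
  unfolding supp4_def
proof (intro allI impI theta_nth_eq_0)
  fix n :: nat and x assume "\<not> 4 dvd n"
  show "int 4 * e x \<noteq> int n"
  proof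
    assume "int 4 * e x = int n"
    hence "int 4 dvd int n" by (metis dvd_triv_left)
    thus False using \<open>\<not> 4 dvd n\<close> by (simp only: int_dvd_int_iff)
  qed
qed

section \<open>The congruence\<close>

text \<open>For these residues 5 divides \<open>6 * n + 1\<close> exactly once; the residue 4 is
  left out because it makes 25 a divisor. As \<open>- 12\<close> is not a square modulo 5,
  divisibility of the form by 5 forces 5 to divide \<open>x\<close> and \<open>m\<close>, hence 25
  to divide the form.\<close>

lemma square_add_12_square_neq:
  fixes x m :: int
  assumes "n mod 25 \<in> {9, 14, 19, 24}"
  shows "x ^ 2 + 12 * m ^ 2 \<noteq> 6 * n + 1"
proof
  assume eq: "x ^ 2 + 12 * m ^ 2 = 6 * n + 1"
  have "6 * n + 1 = (6 * (n mod 25) + 1) + 25 * (6 * (n div 25))"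
    using mult_div_mod_eq[of 25 n] by linarith
  hence "(6 * n + 1) mod 25 = (6 * (n mod 25) + 1) mod 25"
    by (metis mod_mult_self2)
  hence 25: "(6 * n + 1) mod 25 \<in> {5, 10, 15, 20}" using assms by auto
  have "(6 * n + 1) mod 5 = (6 * n + 1) mod 25 mod 5" by (rule mod_mod_cancel[symmetric]) simp
  hence "(6 * n + 1) mod 5 = 0" using 25 by auto
  moreover have "((x mod 5) ^ 2 + 12 * (m mod 5) ^ 2) mod 5 = (x ^ 2 + 12 * m ^ 2) mod 5"
    by (intro mod_add_cong mod_mult_cong refl power_mod)
  ultimately have "((x mod 5) ^ 2 + 12 * (m mod 5) ^ 2) mod 5 = 0"
    unfolding eq[symmetric] by simp
  moreover have "y mod 5 \<in> {0, 1, 2, 3, 4}" for y :: int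
    using pos_mod_bound[of 5 y] pos_mod_sign[of 5 y] by (simp, linarith)
  from this[of x] this[of m] have "x mod 5 = 0 \<and> m mod 5 = 0"
    using calculation by auto
  then obtain a b where "x = 5 * a" "m = 5 * b"
    by (auto dest!: mod_0_imp_dvd elim!: dvdE)
  hence "25 dvd 6 * n + 1" unfolding eq[symmetric] by (simp add: power2_eq_square)
  hence "(6 * n + 1) mod 25 = 0" by (rule dvd_imp_mod_0)
  thus False using 25 by simp
qed

text \<open>Completing the square in 6 times the exponent plus 1 gives
  \<open>(6 * l + (2 * a - 3)) ^ 2 + 12 * j ^ 2\<close>, because \<open>(2 * a - 3) ^ 2 = 1\<close>
  for both values of \<open>a\<close>.\<close>

lemma theta_square_mult_nth_eq_0:
  assumes "int n mod 25 \<in> {9, 14, 19, 24}" "a \<in> {1, 2}"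
  shows "fps_nth (theta UNIV c (\<lambda>l. int 4 * (3 * tri l + a * l)) * theta UNIV d (\<lambda>j. int 2 * j ^ 2)) n = 0"
proof -
  have "int 4 * (3 * tri l + a * l) + int 2 * j ^ 2 \<noteq> int n" for l j
  proof
    assume "int 4 * (3 * tri l + a * l) + int 2 * j ^ 2 = int n"
    hence "(6 * l + (2 * a - 3)) ^ 2 + 12 * j ^ 2 = 6 * int n + 1"
      using two_tri[of l] assms(2) by (auto simp: power2_eq_square algebra_simps)
    thus False using square_add_12_square_neq[OF assms(1)] by blast
  qed
  thus ?thesis
    by (subst theta_mult[OF proper_pentagonal proper_square]) (use assms(2) in \<open>auto intro: theta_nth_eq_0\<close>)
qed

theorem corollary3p2:
  fixes n r :: nat
  assumes "r \<in> {14, 34, 74, 94}"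
  shows "[EO_u (100 * n + r) = 0] (mod 32)"
proof -
  define N where "N = 100 * n + r"
  have "N = r + 4 * (25 * n)" by (simp add: N_def)
  hence "N mod 4 = r mod 4" by (simp only: mod_mult_self2)
  hence N4: "N mod 4 = 2" using assms by auto
  have "int N = int r + 25 * (4 * int n)" by (simp add: N_def)
  hence "int N mod 25 = int r mod 25" by (simp only: mod_mult_self2)
  hence N25: "int N mod 25 \<in> {9, 14, 19, 24}" using assms by auto
  let ?B = EO_u_gf
  define P where "P = theta UNIV alt (\<lambda>j. int 4 * j ^ 2)"
  define Q where "Q = theta UNIV (\<lambda>_. 1) (\<lambda>j. int 2 * j ^ 2)"
  define R where "R = theta UNIV alt (\<lambda>j. int 2 * j ^ 2)"
  define U where "U = theta {0<..} alt (\<lambda>j. int 4 * j ^ 2)"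
  define W where "W = theta {0<..} (\<lambda>_. 1) (\<lambda>j. int 2 * j ^ 2)"
  define V where "V = U + U * U"
  have f4: "euler_f 4 = theta UNIV alt (\<lambda>l. int 4 * (3 * tri l + 1 * l))"
    using pentagonal_number_theorem[of 4] by simp
  have P: "P = 1 + 2 * U" unfolding P_def U_def
    by (rule theta_even_split) (use proper_square[of 4] in auto)
  have Q: "Q = 1 + 2 * W" unfolding Q_def W_def
    by (rule theta_even_split) (use proper_square[of 2] in auto)
  have P2: "P ^ 2 = 1 + 4 * V"
    unfolding P V_def by (simp add: power2_eq_square algebra_simps)
  \<comment> \<open>Gauss' identity puts a factor \<open>euler_f 4\<close> into
    \<open>(euler_f 2) ^ 2\<close>, so one such factor cancels from the defining relation.\<close>
  have "(?B * theta UNIV alt (\<lambda>j. int 2 * j ^ 2)) * euler_f 4 = euler_f 4 * euler_f 4"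
    using EO_u_gf_times gauss_square_theorem[of 2] by (simp add: power2_eq_square mult_ac)
  hence BR: "?B * R = euler_f 4"
    using euler_f_nonzero[of 4] by (simp add: R_def)
  have "P ^ 2 = R * Q"
    using theta_square_product[of 2] unfolding P_def Q_def R_def by (simp add: mult.commute)
  hence BP: "?B * P ^ 2 = euler_f 4 * Q"
    by (simp only: BR mult.assoc[symmetric])
  have V4: "supp4 V" unfolding V_def U_def by (intro supp4_add supp4_mult supp4_theta)
  have f44: "supp4 (euler_f 4)" unfolding f4 by (rule supp4_theta)
  \<comment> \<open>Modulo 2, \<open>?B\<close> is congruent to \<open>euler_f 4\<close>, a series
    in \<open>q ^ 4\<close>.\<close>
  have even: "even (fps_nth ?B m)" if "m mod 4 = 2" for m
  proof -
    have "?B = euler_f 4 + 2 * (euler_f 4 * W - 2 * (V * ?B))"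
      using BP unfolding P2 Q by (simp add: algebra_simps)
    hence "fps_nth ?B m = fps_nth (euler_f 4) m + fps_nth (2 * (euler_f 4 * W - 2 * (V * ?B))) m"
      by (metis fps_add_nth)
    moreover have "fps_nth (euler_f 4) m = 0"
      using f44 that by (auto simp: supp4_def dvd_eq_mod_eq_0)
    ultimately show ?thesis by (simp add: fps_numeral_fps_const)
  qed
  \<comment> \<open>Only indices \<open>i\<close> divisible by 4 contribute from
    \<open>V * V\<close>, and then \<open>N - i\<close> is still 2 modulo 4, where \<open>?B\<close>
    has even coefficients.\<close>
  have "even (fps_nth (V * V * ?B) N)"
    unfolding fps_mult_nth[of "V * V"]
  proof (rule dvd_sum)
    fix i assume i: "i \<in> {0..N}"
    show "even (fps_nth (V * V) i * fps_nth ?B (N - i))"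
    proof (cases "4 dvd i")
      case True
      then obtain t where "i = 4 * t" by (rule dvdE)
      hence "N = (N - i) + 4 * t" using i by simp
      hence "(N - i) mod 4 = 2" using N4 by (metis mod_mult_self2)
      hence "even (fps_nth ?B (N - i))" by (rule even)
      thus ?thesis by (rule dvd_mult)
    next
      case False
      thus ?thesis using supp4_mult[OF V4 V4] by (simp add: supp4_def)
    qed
  qed
  then obtain t where t: "fps_nth (V * V * ?B) N = 2 * t" by (rule evenE)
  \<comment> \<open>\<open>1 / P\<^sup>2 = 1 / (1 + 4 * V)\<close> is congruent to \<open>1 - 4 * V = 2 - P\<^sup>2\<close> modulo 16.\<close>
  have "?B = 16 * (V * V * ?B) + (?B * (1 + 4 * V)) * (1 - 4 * V)"
    by (simp add: algebra_simps)
  also have "?B * (1 + 4 * V) = euler_f 4 * Q"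
    using BP by (simp only: P2)
  also have "1 - 4 * V = 2 - P ^ 2"
    by (simp add: P2)
  \<comment> \<open>Grouping \<open>euler_f 4\<close> with \<open>P ^ 2\<close> yields two products
    covered by \<open>theta_square_mult_nth_eq_0\<close>, with \<open>a = 1\<close> and
    \<open>a = 2\<close>; both vanish at \<open>N\<close>.\<close>
  also have "16 * (V * V * ?B) + euler_f 4 * Q * (2 - P ^ 2)
      = 16 * (V * V * ?B) + 2 * (euler_f 4 * Q) - (euler_f 4 * P ^ 2) * Q"
    by (simp add: algebra_simps)
  finally have "fps_nth ?B N
      = fps_nth (16 * (V * V * ?B) + 2 * (euler_f 4 * Q) - (euler_f 4 * P ^ 2) * Q) N"
    by (rule arg_cong)
  also have "\<dots> = 16 * fps_nth (V * V * ?B) N + 2 * fps_nth (euler_f 4 * Q) N - fps_nth ((euler_f 4 * P ^ 2) * Q) N"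
    by (simp only: fps_add_nth fps_sub_nth fps_numeral_fps_const fps_mult_left_const_nth)
  also have "fps_nth (euler_f 4 * Q) N = 0"
    unfolding f4 Q_def by (rule theta_square_mult_nth_eq_0[OF N25]) simp
  also have "fps_nth ((euler_f 4 * P ^ 2) * Q) N = 0"
    using euler_f_times_theta_square[of 4] theta_square_mult_nth_eq_0[OF N25, of 2]
    unfolding P_def Q_def by simp
  finally have "32 dvd fps_nth ?B N"
    by (simp add: t)
  thus ?thesis by (simp add: cong_0_iff EO_u_def N_def)
qed

end
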